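(* Let $q>2$ be a prime power, let $\bm a\in\mathbb F_{q^2}^n$ have distinct entries, $\bm v\in(\mathbb F_{q^2}^* )^n$, $1\le k\le n-1$, and let $\mathcal C=GRS_k(\bm a,\bm v)$ be the $[n,k]_{q^2}$ GRS code with generator matrix $G=G_k(\bm a,\bm v)$ and with $l$-dimensional Hermitian hull, $0\le l\le k$. Let $\bm w$ be either $\bm w=\bm g_k$, or, in the case $n<q^2$ and $\bm a\in(\mathbb F_{q^2}^* )^n$, $\bm w=\bm g_{-1}$. Then the following hold. (1) If $\bm w\in\mathcal C^{\perp_H}$ and $\bm w\bm w^\dagger=0$, then for each $0\le s\le l+1$ there exists an $[n,k+1]_{q^2}$ GRS code with $s$-dimensional Hermitian hull. (2) If $\bm w\notin(\mathrm{Hull}_H(\mathcal C))^{\perp_H}$, then for each $0\le s\le l-1$ there exists an $[n,k+1]_{q^2}$ GRS code with $s$-dimensional Hermitian hull. (3) If $\bm w\in(\mathrm{Hull}_H(\mathcal C))^{\perp_H}$, then for each $0\le s\le l$ there exists an $[n,k+1]_{q^2}$ GRS code with $s$-dimensional Hermitian hull. (4) If $\bm w\bm w^\dagger\ne0$, then the $n\times n$ matrix $S=(\bm w\bm w^\dagger)E_n-\bm w^\dagger\bm w$ has rank $n-1$, and for each $0\le s\le k-\mathrm{rank}(GSG^\dagger)$ there exists an $[n,k+1]_{q^2}$ GRS code with $s$-dimensional Hermitian hull.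
   Context: For a matrix $A=(a_{ij})$ over $\mathbb F_{q^2}$ (row vectors included), $A^\dagger=(a_{ji}^q)$; $E_n$ is the $n\times n$ identity matrix. For a linear code $\mathcal C\subseteq\mathbb F_{q^2}^n$, $\mathcal C^{\perp_H}=\{\bm x:\sum_i y_ix_i^q=0\ \text{for all }\bm y\in\mathcal C\}$ and $\mathrm{Hull}_H(\mathcal C)=\mathcal C\cap\mathcal C^{\perp_H}$. For $\bm a$ with distinct entries and $\bm v\in(\mathbb F_{q^2}^* )^n$, the GRS code is $GRS_k(\bm a,\bm v)=\{(v_1f(a_1),\dots,v_nf(a_n)):f\in\mathbb F_{q^2}[x],\deg f\le k-1\}$, $1\le k\le n$. For an integer $i$, $\bm g_i$ is the row vector $(v_1a_1^i,\dots,v_na_n^i)$ (with $0^0=1$; for $i=-1$ all $a_j$ must be nonzero), and $G_k(\bm a,\bm v)$ is the generator matrix with rows $\bm g_0,\dots,\bm g_{k-1}$. A GRS code means a code of the form $GRS_k(\bm a,\bm v)$ for some $\bm a,\bm v$. *)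

theory Defs
  imports
    "Jordan_Normal_Form.DL_Rank"
    "HOL-Number_Theory.Prime_Powers"
    "HOL-Computational_Algebra.Polynomial"
begin

text \<open>
  The ground field is a finite field type \<open>'a\<close> of cardinality \<open>q\<^sup>2\<close>. The number \<open>q\<close> is passed
  explicitly wherever the conjugation \<open>x \<mapsto> x ^ q\<close> is used.
\<close>

definition hdagger :: "nat \<Rightarrow> 'a::field mat \<Rightarrow> 'a mat" where
  "hdagger q A = map_mat (\<lambda>x. x ^ q) (transpose_mat A)"

text \<open>The scalar \<open>w w\<^sup>\<dagger>\<close>, i.e. the entry of the corresponding \<open>1 \<times> 1\<close> matrix.\<close>

definition herm_sq :: "nat \<Rightarrow> 'a::field vec \<Rightarrow> 'a" where
  "herm_sq q w = (mat_of_row w * hdagger q (mat_of_row w)) $$ (0, 0)"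

definition code_dim :: "nat \<Rightarrow> 'a::field vec set \<Rightarrow> nat" where
  "code_dim n C = vectorspace.dim class_ring ((module_vec TYPE('a) n)\<lparr>carrier := C\<rparr>)"

definition linear_code :: "nat \<Rightarrow> nat \<Rightarrow> 'a::field vec set \<Rightarrow> bool" where
  "linear_code n k C \<longleftrightarrow>
     VectorSpace.subspace class_ring C (module_vec TYPE('a) n) \<and> code_dim n C = k"

definition herm_dual :: "nat \<Rightarrow> nat \<Rightarrow> 'a::field vec set \<Rightarrow> 'a vec set" where
  "herm_dual q n C = {x \<in> carrier_vec n. \<forall>y\<in>C. (\<Sum>i<n. y $ i * (x $ i) ^ q) = 0}"

definition herm_hull :: "nat \<Rightarrow> nat \<Rightarrow> 'a::field vec set \<Rightarrow> 'a vec set" where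
  "herm_hull q n C = C \<inter> herm_dual q n C"

definition GRS_params :: "nat \<Rightarrow> 'a::field vec \<Rightarrow> 'a vec \<Rightarrow> bool" where
  "GRS_params n a v \<longleftrightarrow> a \<in> carrier_vec n \<and> v \<in> carrier_vec n \<and>
     inj_on (\<lambda>j. a $ j) {..<n} \<and> (\<forall>j<n. v $ j \<noteq> 0)"

text \<open>Only used for \<open>k \<ge> 1\<close>, so the subtraction does not truncate.\<close>

definition GRS :: "nat \<Rightarrow> nat \<Rightarrow> 'a::field vec \<Rightarrow> 'a vec \<Rightarrow> 'a vec set" where
  "GRS n k a v = {vec n (\<lambda>j. v $ j * poly f (a $ j)) | f. degree f \<le> k - 1}"

definition is_GRS_code :: "nat \<Rightarrow> 'a::field vec set \<Rightarrow> bool" where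
  "is_GRS_code n C \<longleftrightarrow>
     (\<exists>k a v. 1 \<le> k \<and> k \<le> n \<and> GRS_params n a v \<and> C = GRS n k a v)"

text \<open>
  Note \<open>0 powi 0 = 1\<close>. For \<open>i < 0\<close> the vector is meaningful only if all entries of \<open>a\<close> are
  nonzero.
\<close>

definition GRS_row :: "nat \<Rightarrow> 'a::field vec \<Rightarrow> 'a vec \<Rightarrow> int \<Rightarrow> 'a vec" where
  "GRS_row n a v i = vec n (\<lambda>j. v $ j * (a $ j) powi i)"

definition GRS_gen_mat :: "nat \<Rightarrow> nat \<Rightarrow> 'a::field vec \<Rightarrow> 'a vec \<Rightarrow> 'a mat" where
  "GRS_gen_mat n k a v = mat_of_rows n (map (\<lambda>i. GRS_row n a v (int i)) [0..<k])"

end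

theory Submission
  imports Defs "Jordan_Normal_Form.Matrix_Kernel"
begin

text \<open>
  Let \<open>C'\<close> be the code spanned by \<open>C\<close> and \<open>w\<close>; it is again a GRS code, with the same
  evaluation points and, for \<open>w = g\<^sub>-\<^sub>1\<close>, with multipliers \<open>v\<^sub>j / a\<^sub>j\<close>. In each of the four
  cases the hull of \<open>C'\<close> has at least the largest claimed dimension. Since \<open>q > 2\<close> there is
  \<open>\<alpha> \<noteq> 0\<close> with \<open>\<alpha>\<^sup>q\<^sup>+\<^sup>1 \<noteq> 1\<close>; multiplying by \<open>\<alpha>\<close> a coordinate at which the hull does not
  vanish lowers the hull dimension by exactly one, so that all smaller dimensions occur as well.
  Dimensions of subspaces are compared by counting, as the field is finite.
\<close>

section \<open>Counting in finite vector spaces\<close>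

text \<open>Multiplication by a nonzero x permutes the nonzero elements. Comparing the products over
  them and cancelling gives exponent card - 1; one more factor x gives the claim.\<close>

lemma finite_field_pow_card:
  fixes x :: "'a::{field,finite}"
  shows "x ^ card (UNIV :: 'a set) = x"
proof (cases "x = 0")
  case False
  have "bij_betw (\<lambda>y. x * y) (UNIV - {0}) (UNIV - {0})"
    by (rule bij_betw_byWitness[where f' = "\<lambda>y. y / x"]) (use False in auto)
  then have "(\<Prod>y\<in>UNIV - {0}. x * y) = \<Prod>(UNIV - {0})"
    by (rule prod.reindex_bij_betw[where g = "\<lambda>y. y"])
  then have "x ^ card (UNIV - {0 :: 'a}) = 1"
    by (simp add: prod.distrib)
  then have "x ^ Suc (card (UNIV - {0 :: 'a})) = x"
    by simp
  also have "Suc (card (UNIV - {0 :: 'a})) = card (UNIV :: 'a set)"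
    using finite_UNIV_card_ge_0[where ?'a = 'a] by (simp add: card_Diff_singleton)
  finally show ?thesis .
qed (simp add: finite_UNIV_card_ge_0)

lemma one_less_card_field: "1 < card (UNIV :: 'a::{field,finite} set)"
  using card_mono[of "UNIV :: 'a set" "{0, 1}"] by simp

section \<open>Subspaces and their cardinality\<close>

definition lin_closed :: "nat \<Rightarrow> 'a::field vec set \<Rightarrow> bool" where
  "lin_closed n V \<longleftrightarrow> V \<subseteq> carrier_vec n \<and> 0\<^sub>v n \<in> V \<and>
     (\<forall>x\<in>V. \<forall>y\<in>V. x + y \<in> V) \<and> (\<forall>c. \<forall>x\<in>V. c \<cdot>\<^sub>v x \<in> V)"

lemma lin_closedD:
  assumes "lin_closed n V"
  shows "V \<subseteq> carrier_vec n" "0\<^sub>v n \<in> V"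
    "\<And>x y. x \<in> V \<Longrightarrow> y \<in> V \<Longrightarrow> x + y \<in> V" "\<And>c x. x \<in> V \<Longrightarrow> c \<cdot>\<^sub>v x \<in> V"
  using assms by (auto simp: lin_closed_def)

lemma lin_closed_diff:
  assumes "lin_closed n V" "x \<in> V" "y \<in> V"
  shows "x - y \<in> V"
proof -
  have "x + (-1) \<cdot>\<^sub>v y \<in> V"
    by (intro lin_closedD(3,4)[OF assms(1)] assms(2,3))
  also have "x + (-1) \<cdot>\<^sub>v y = x - y"
    using carrier_vecD[of x n] carrier_vecD[of y n] lin_closedD(1)[OF assms(1)] assms(2,3)
    by (simp add: vec_eq_iff subset_iff)
  finally show ?thesis .
qed

lemma finite_carrier_vec: "finite (carrier_vec n :: 'a::finite vec set)"
proof (rule finite_subset)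
  show "carrier_vec n \<subseteq> vec_of_list ` {xs :: 'a list. set xs \<subseteq> UNIV \<and> length xs = n}"
  proof
    fix v :: "'a vec" assume "v \<in> carrier_vec n"
    then show "v \<in> vec_of_list ` {xs. set xs \<subseteq> UNIV \<and> length xs = n}"
      by (intro image_eqI[of _ _ "list_of_vec v"]) (auto simp: vec_list)
  qed
qed (intro finite_imageI finite_lists_length_eq finite_UNIV)

lemma lin_closed_finite: "lin_closed n V \<Longrightarrow> finite (V :: 'a::{field,finite} vec set)"
  using finite_carrier_vec finite_subset lin_closedD(1) by blast

text \<open>Bridge from the elementwise closure conditions, in which all arguments below are carried
  out, to the abstract subspaces on which \<open>code_dim\<close> is defined.\<close>

lemma lin_closed_subspace:
  fixes V :: "'a::field vec set"
  assumes "lin_closed n V"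
  shows "VectorSpace.subspace class_ring V (module_vec TYPE('a) n)"
proof -
  interpret vec_space "TYPE('a)" n .
  show ?thesis
    unfolding VectorSpace.subspace_def submodule_def
    using lin_closedD[OF assms] module_axioms vectorspace_axioms
    by (auto simp: module_vec_simps)
qed

text \<open>A finite carrier generates itself, so a finite basis exists. Taking coordinates
  identifies vectors with extensional coefficient functions on that basis, and these are
  counted.\<close>

lemma card_vectorspace:
  assumes "vectorspace K V" and "finite (carrier V)"
  shows "card (carrier V) = card (carrier K) ^ vectorspace.dim K V"
proof -
  interpret vectorspace K V by fact
  have "gen_set (carrier V)"
    using in_own_span[of "carrier V"] span_is_subset2[of "carrier V"] by auto
  then have fin_dim
    using assms(2) unfolding fin_dim_def by blast
  then obtain B where B: "finite B" "basis B"
    using finite_basis_exists by blast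
  then have BV: "B \<subseteq> carrier V" and dim: "dim = card B"
    using dim_basis unfolding basis_def by auto
  have uniq: "\<exists>!c. c \<in> B \<rightarrow>\<^sub>E carrier K \<and> lincomb c B = v" if "v \<in> carrier V" for v
    using basis_criterion[OF B(1) BV] B(2) that by blast
  have "bij_betw (\<lambda>c. lincomb c B) (B \<rightarrow>\<^sub>E carrier K) (carrier V)"
  proof (rule bij_betwI')
    show closed: "lincomb c B \<in> carrier V" if "c \<in> B \<rightarrow>\<^sub>E carrier K" for c
      using that BV by (intro lincomb_closed) auto
    show "lincomb c B = lincomb d B \<longleftrightarrow> c = d"
      if "c \<in> B \<rightarrow>\<^sub>E carrier K" "d \<in> B \<rightarrow>\<^sub>E carrier K" for c d
      using uniq[OF closed[OF that(1)]] that by auto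
    show "\<exists>c\<in>B \<rightarrow>\<^sub>E carrier K. v = lincomb c B" if "v \<in> carrier V" for v
      using uniq[OF that] by blast
  qed
  then have "card (carrier V) = card (B \<rightarrow>\<^sub>E carrier K)"
    by (simp add: bij_betw_same_card)
  then show ?thesis
    using B(1) dim by (simp add: card_PiE)
qed

lemma card_subspace_eq:
  fixes V :: "'a::{field,finite} vec set"
  assumes "lin_closed n V"
  shows "card V = card (UNIV :: 'a set) ^ code_dim n V"
proof -
  interpret vec_space "TYPE('a)" n .
  show ?thesis
    using card_vectorspace[OF subspace_is_vs[OF lin_closed_subspace[OF assms]]]
      lin_closed_finite[OF assms]
    by (simp add: code_dim_def)
qed

text \<open>Turns a lower bound on the number of vectors into one on the dimension; every hull bound
  below is obtained this way.\<close>

lemma card_le_imp_le_code_dim: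
  fixes V :: "'a::{field,finite} vec set"
  assumes "lin_closed n V" and "card (UNIV :: 'a set) ^ m \<le> card V"
  shows "m \<le> code_dim n V"
  using assms(2) card_subspace_eq[OF assms(1)] power_le_imp_le_exp[OF one_less_card_field] by metis

text \<open>The fibres of f are translates of K. After choosing a preimage \<open>p y\<close> of
  each value y, every vector is \<open>p y + k\<close> for exactly one pair. Stating this through
  fibres lets it serve matrix maps and scalar functionals alike.\<close>

lemma card_eq_card_image_times_kernel:
  fixes V :: "'a::{field,finite} vec set"
  assumes V: "lin_closed n V" and "K \<subseteq> V"
    and f: "\<And>x y. x \<in> V \<Longrightarrow> y \<in> V \<Longrightarrow> f x = f y \<longleftrightarrow> x - y \<in> K"
  shows "card V = card (f ` V) * card K"
proof -
  define p where "p = inv_into V f"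
  have p: "p y \<in> V" "f (p y) = y" if "y \<in> f ` V" for y
    using that by (simp_all add: p_def inv_into_into f_inv_into_f)
  have carr: "x \<in> carrier_vec n" if "x \<in> V" for x
    using V that lin_closedD(1) by blast
  have cancel: "p y + k - p y = k" if "y \<in> f ` V" "k \<in> K" for y k
    using carr[OF p(1)[OF that(1)]] carr[of k] that(2) assms(2) by (intro eq_vecI) auto
  have inV: "p y + k \<in> V" if "y \<in> f ` V" "k \<in> K" for y k
    using that p(1) assms(2) V lin_closedD(3) by blast
  have fpk: "f (p y + k) = y" if "y \<in> f ` V" "k \<in> K" for y k
    using f[OF inV[OF that] p(1)[OF that(1)]] cancel[OF that] p(2) that by simp
  have uniq: "y = y' \<and> k = k'"
    if yk: "y \<in> f ` V" "k \<in> K" and yk': "y' \<in> f ` V" "k' \<in> K" and eq: "p y + k = p y' + k'"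
    for y k y' k'
  proof
    have "y = f (p y + k)"
      by (rule fpk[OF yk, symmetric])
    also have "\<dots> = y'"
      unfolding eq by (rule fpk[OF yk'])
    finally show y: "y = y'" .
    have "k = p y + k - p y"
      by (rule cancel[OF yk, symmetric])
    also have "\<dots> = p y' + k' - p y'"
      unfolding eq by (simp only: y)
    also have "\<dots> = k'"
      by (rule cancel[OF yk'])
    finally show "k = k'" .
  qed
  have "bij_betw (\<lambda>(y, k). p y + k) (f ` V \<times> K) V"
    unfolding bij_betw_def
  proof
    show "inj_on (\<lambda>(y, k). p y + k) (f ` V \<times> K)"
    proof (rule inj_onI)
      fix a b
      assume "a \<in> f ` V \<times> K" "b \<in> f ` V \<times> K"
        and "(case a of (y, k) \<Rightarrow> p y + k) = (case b of (y, k) \<Rightarrow> p y + k)"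
      then show "a = b"
        using uniq[of "fst a" "snd a" "fst b" "snd b"]
        by (simp add: case_prod_unfold mem_Times_iff prod_eq_iff)
    qed
    show "(\<lambda>(y, k). p y + k) ` (f ` V \<times> K) = V"
    proof
      show "(\<lambda>(y, k). p y + k) ` (f ` V \<times> K) \<subseteq> V"
        using inV by auto
      show "V \<subseteq> (\<lambda>(y, k). p y + k) ` (f ` V \<times> K)"
      proof
        fix x assume x: "x \<in> V"
        then have y: "p (f x) \<in> V" "f (p (f x)) = f x"
          using p by auto
        then have "x - p (f x) \<in> K"
          using f x by metis
        moreover have "x = p (f x) + (x - p (f x))"
          using carrier_vecD[OF carr[OF x]] carrier_vecD[OF carr[OF y(1)]] by (simp add: vec_eq_iff)
        ultimately show "x \<in> (\<lambda>(y, k). p y + k) ` (f ` V \<times> K)"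
          using x by (intro image_eqI[of _ _ "(f x, x - p (f x))"]) auto
      qed
    qed
  qed
  then show ?thesis
    by (metis bij_betw_same_card card_cartesian_product)
qed

lemma lin_closed_carrier_vec: "lin_closed n (carrier_vec n)"
  by (simp add: lin_closed_def)

lemma card_carrier_vec:
  "card (carrier_vec n :: 'a::{field,finite} vec set) = card (UNIV :: 'a set) ^ n"
proof -
  interpret vec_space "TYPE('a)" n .
  have "module_vec TYPE('a) n\<lparr>carrier := carrier_vec n\<rparr> = module_vec TYPE('a) n"
    by (simp add: module_vec_def)
  then have "code_dim n (carrier_vec n :: 'a vec set) = n"
    unfolding code_dim_def by (simp only: dim_is_n)
  then show ?thesis
    using card_subspace_eq[OF lin_closed_carrier_vec[of n, where ?'a = 'a]] by simp
qed

text \<open>Rank-nullity in counted form: the image of the matrix map is the column space, whose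
  dimension is the rank, and its fibres are translates of the kernel.\<close>

lemma card_mat_kernel:
  fixes A :: "'a::{field,finite} mat"
  assumes A: "A \<in> carrier_mat nr nc"
  shows "card (mat_kernel A) * card (UNIV :: 'a set) ^ vec_space.rank nr A = card (UNIV :: 'a set) ^ nc"
proof -
  interpret vec_space "TYPE('a)" nr .
  define f where "f = (\<lambda>x. A *\<^sub>v x)"
  have im: "f ` carrier_vec nc = span (set (cols A))"
    using col_space_eq[OF A] A by (auto simp: col_space_def f_def)
  have "lin_closed nr (f ` carrier_vec nc)"
    unfolding lin_closed_def
  proof (intro conjI ballI allI)
    show "f ` carrier_vec nc \<subseteq> carrier_vec nr"
      using A by (auto simp: f_def)
    show "0\<^sub>v nr \<in> f ` carrier_vec nc"
      by (rule image_eqI[of _ _ "0\<^sub>v nc"]) (use A in \<open>auto simp: f_def\<close>)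
    fix y assume "y \<in> f ` carrier_vec nc"
    then obtain x where x: "x \<in> carrier_vec nc" "y = A *\<^sub>v x" by (auto simp: f_def)
    show "c \<cdot>\<^sub>v y \<in> f ` carrier_vec nc" for c
      by (rule image_eqI[of _ _ "c \<cdot>\<^sub>v x"]) (use A x in \<open>auto simp: f_def mult_mat_vec\<close>)
    fix y' assume "y' \<in> f ` carrier_vec nc"
    then obtain x' where x': "x' \<in> carrier_vec nc" "y' = A *\<^sub>v x'" by (auto simp: f_def)
    show "y + y' \<in> f ` carrier_vec nc"
      by (rule image_eqI[of _ _ "x + x'"]) (use A x x' in \<open>auto simp: f_def mult_add_distrib_mat_vec\<close>)
  qed
  from card_subspace_eq[OF this]
  have r: "card (f ` carrier_vec nc) = card (UNIV :: 'a set) ^ rank A"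
    by (simp add: im rank_def code_dim_def)
  have "card (carrier_vec nc :: 'a vec set) = card (f ` carrier_vec nc) * card (mat_kernel A)"
  proof (rule card_eq_card_image_times_kernel[OF lin_closed_carrier_vec])
    show "mat_kernel A \<subseteq> carrier_vec nc"
      by (rule mat_kernel_carrier[OF A])
    fix x y :: "'a vec" assume xy: "x \<in> carrier_vec nc" "y \<in> carrier_vec nc"
    have "A *\<^sub>v (x - y) = A *\<^sub>v x - A *\<^sub>v y"
      using A xy by (rule mult_minus_distrib_mat_vec)
    moreover have "A *\<^sub>v x - A *\<^sub>v y = 0\<^sub>v nr \<longleftrightarrow> A *\<^sub>v x = A *\<^sub>v y"
      using A xy by (auto simp: vec_eq_iff)
    ultimately show "f x = f y \<longleftrightarrow> x - y \<in> mat_kernel A"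
      using xy by (simp add: f_def mat_kernel[OF A])
  qed
  then show ?thesis
    by (simp add: card_carrier_vec r mult.commute)
qed

section \<open>Characteristic, polynomials and generator matrices\<close>

lemma CHAR_dvd_card: "CHAR('a::{field,finite}) dvd card (UNIV :: 'a set)"
proof -
  \<comment> \<open>Shifting by 1 permutes the field, so the two sums agree although they differ by
    the cardinality times 1.\<close>
  have "(\<Sum>x\<in>UNIV. x) = (\<Sum>x\<in>UNIV. x + (1 :: 'a))"
    by (rule sum.reindex_bij_witness[of _ "\<lambda>x. x + 1" "\<lambda>x. x - 1"]) auto
  then show ?thesis
    by (simp add: sum.distrib of_nat_eq_0_iff_char_dvd)
qed


lemma card_poly_degree_le:
  "card {f :: 'a::{field,finite} poly. degree f \<le> d} = card (UNIV :: 'a set) ^ (d + 1)"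
proof (induction d)
  case 0
  have "bij_betw (\<lambda>c. [:c:]) UNIV {f :: 'a poly. degree f \<le> 0}"
    by (rule bij_betwI') (auto elim: degree_eq_zeroE)
  then show ?case
    by (simp add: bij_betw_same_card[symmetric])
next
  case (Suc d)
  \<comment> \<open>Splitting off the constant coefficient lowers the degree bound by one.\<close>
  have "bij_betw (\<lambda>(c, f). pCons c f) (UNIV \<times> {f :: 'a poly. degree f \<le> d})
          {f. degree f \<le> Suc d}"
  proof (rule bij_betwI')
    fix f :: "'a poly" assume "f \<in> {f. degree f \<le> Suc d}"
    then show "\<exists>x\<in>UNIV \<times> {f. degree f \<le> d}. f = (case x of (c, f) \<Rightarrow> pCons c f)"
      by (cases f) (auto split: if_splits)
  qed (auto simp: degree_pCons_eq_if)
  then show ?case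
    using Suc by (simp add: bij_betw_same_card[symmetric] card_cartesian_product)
qed

lemma poly_eq_sum_lessThan:
  fixes f :: "'a::comm_ring_1 poly"
  assumes "degree f \<le> k - 1" "1 \<le> k"
  shows "poly f x = (\<Sum>i<k. coeff f i * x ^ i)"
proof -
  have "poly f x = (\<Sum>i\<le>degree f. coeff f i * x ^ i)"
    by (rule poly_altdef)
  also have "\<dots> = (\<Sum>i<k. coeff f i * x ^ i)"
    by (rule sum.mono_neutral_left) (use assms in \<open>auto simp: coeff_eq_0\<close>)
  finally show ?thesis .
qed

lemma GRS_gen_mat_carrier [simp]: "GRS_gen_mat n k a v \<in> carrier_mat k n"
  by (simp add: GRS_gen_mat_def mat_of_rows_def)

lemma GRS_gen_mat_index:
  "i < k \<Longrightarrow> j < n \<Longrightarrow> GRS_gen_mat n k a v $$ (i, j) = v $ j * (a $ j) ^ i"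
  by (simp add: GRS_gen_mat_def mat_of_rows_index GRS_row_def)

section \<open>Hermitian hulls and coordinate scaling\<close>

locale hermitian_space =
  fixes q :: nat and ty :: "'a::{field,finite} itself"
  assumes primepow_q: "primepow q" and q_gt_2: "q > 2" and card_field: "card (UNIV :: 'a set) = q ^ 2"
begin

lemma q_pos [simp]: "0 < q" "q \<noteq> 0"
  using q_gt_2 by simp_all

text \<open>The characteristic is a prime dividing \<open>q ^ 2\<close>, hence the prime of which q
  is a power. This makes \<open>x ^ q\<close> additive, as an iterated Frobenius map.\<close>

lemma char_power: "\<exists>m. prime CHAR('a) \<and> q = CHAR('a) ^ m"
proof -
  have pr: "prime CHAR('a)"
    using finite_imp_CHAR_pos[where ?'a = 'a] prime_CHAR_semidom[where ?'a = 'a] by simp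
  obtain p m where p: "prime p" "q = p ^ m"
    using primepow_q by (auto simp: primepow_def)
  have "CHAR('a) dvd q ^ 2"
    using CHAR_dvd_card[where ?'a = 'a] card_field by simp
  then have "CHAR('a) = p"
    using pr p prime_dvd_power primes_dvd_imp_eq by metis
  then show ?thesis
    using pr p by blast
qed

lemma conj_add: "(x + y :: 'a) ^ q = x ^ q + y ^ q"
  using char_power freshmans_dream' by blast

lemma conj_sum: "sum f A ^ q = (\<Sum>i\<in>A. f i ^ q :: 'a)"
  using char_power freshmans_dream_sum' by blast

lemma conj_conj [simp]: "((x :: 'a) ^ q) ^ q = x"
  using finite_field_pow_card[of x] by (simp add: card_field power2_eq_square power_mult)

lemma conj_inj: "(x :: 'a) ^ q = y ^ q \<longleftrightarrow> x = y"
  by (metis conj_conj)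

text \<open>Otherwise the polynomial p below, of degree at most q + 2, would vanish on all
  \<open>q ^ 2\<close> elements; its extra factor x covers the root 0. This is where q > 2 enters:
  over the field with 4 elements every nonzero element has norm 1.\<close>

lemma exists_norm_ne_1: "\<exists>\<alpha> :: 'a. \<alpha> \<noteq> 0 \<and> \<alpha> ^ (q + 1) \<noteq> 1"
proof (rule ccontr)
  assume "\<nexists>\<alpha> :: 'a. \<alpha> \<noteq> 0 \<and> \<alpha> ^ (q + 1) \<noteq> 1"
  then have all: "\<alpha> ^ (q + 1) = 1" if "\<alpha> \<noteq> 0" for \<alpha> :: 'a
    using that by blast
  define p :: "'a poly" where "p = monom 1 (q + 2) - monom 1 1"
  have "coeff p (q + 2) = 1"
    by (simp add: p_def)
  then have p0: "p \<noteq> 0"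
    by auto
  have "poly p x = 0" for x
    using all[of x] by (cases "x = 0") (auto simp: p_def poly_monom)
  then have "card (UNIV :: 'a set) = card {x. poly p x = 0}"
    by simp
  also have "\<dots> \<le> degree p"
    by (rule card_poly_roots_bound[OF p0])
  also have "\<dots> \<le> q + 2"
    unfolding p_def by (intro degree_diff_le order.trans[OF degree_monom_le]) auto
  finally have "q * q \<le> q + 2"
    by (simp add: card_field power2_eq_square)
  moreover have "3 * q \<le> q * q"
    using q_gt_2 by (intro mult_le_mono1) simp
  ultimately show False
    using q_gt_2 by linarith
qed

section \<open>The Hermitian form and its hulls\<close>

definition herm :: "nat \<Rightarrow> 'a vec \<Rightarrow> 'a vec \<Rightarrow> 'a" where
  "herm n x y = (\<Sum>i<n. x $ i * (y $ i) ^ q)"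

text \<open>Conjugation is an additive and multiplicative involution, so it swaps the arguments. The
  laws for the right argument and the symmetry of orthogonality come from this.\<close>

lemma herm_conj: "(herm n x y) ^ q = herm n y x"
  by (simp add: herm_def conj_sum power_mult_distrib mult.commute)

lemma herm_add_left:
  "x \<in> carrier_vec n \<Longrightarrow> y \<in> carrier_vec n \<Longrightarrow> herm n (x + y) z = herm n x z + herm n y z"
  by (simp add: herm_def algebra_simps sum.distrib)

lemma herm_smult_left: "x \<in> carrier_vec n \<Longrightarrow> herm n (c \<cdot>\<^sub>v x) z = c * herm n x z"
  by (simp add: herm_def algebra_simps sum_distrib_left)

lemma herm_add_right:
  "x \<in> carrier_vec n \<Longrightarrow> y \<in> carrier_vec n \<Longrightarrow> herm n z (x + y) = herm n z x + herm n z y"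
  by (metis herm_conj herm_add_left conj_add)

lemma herm_smult_right: "x \<in> carrier_vec n \<Longrightarrow> herm n z (c \<cdot>\<^sub>v x) = c ^ q * herm n z x"
  by (metis herm_conj herm_smult_left power_mult_distrib)

lemma herm_zero_right [simp]: "herm n z (0\<^sub>v n) = 0"
  by (simp add: herm_def)

lemma herm_dual_eq: "herm_dual q n C = {x \<in> carrier_vec n. \<forall>y\<in>C. herm n y x = 0}"
  by (simp add: herm_dual_def herm_def)

lemma herm_sq_eq: "w \<in> carrier_vec n \<Longrightarrow> herm_sq q w = herm n w w"
  by (simp add: herm_sq_def hdagger_def herm_def mat_of_row_def scalar_prod_def lessThan_atLeast0)

lemma lin_closed_hull:
  fixes C :: "'a vec set"
  assumes "lin_closed n C"
  shows "lin_closed n (herm_hull q n C)"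
  unfolding lin_closed_def
  using lin_closedD[OF assms]
  by (auto simp: herm_hull_def herm_dual_eq herm_add_right herm_smult_right subset_iff)

lemma hull_memI:
  fixes C :: "'a vec set"
  assumes "lin_closed n C" "x \<in> C" "\<And>y. y \<in> C \<Longrightarrow> herm n y x = 0"
  shows "x \<in> herm_hull q n C"
  using assms lin_closedD(1)[OF assms(1)] by (auto simp: herm_hull_def herm_dual_eq)

lemma hull_memD:
  assumes "x \<in> herm_hull q n C"
  shows "x \<in> C" "x \<in> carrier_vec n" "y \<in> C \<Longrightarrow> herm n y x = 0" "y \<in> C \<Longrightarrow> herm n x y = 0"
proof -
  show "x \<in> C" "x \<in> carrier_vec n" "y \<in> C \<Longrightarrow> herm n y x = 0"
    using assms by (auto simp: herm_hull_def herm_dual_eq)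
  then show "y \<in> C \<Longrightarrow> herm n x y = 0"
    using herm_conj[of n y x] by (simp add: power_0_left)
qed

definition scale_at :: "nat \<Rightarrow> nat \<Rightarrow> 'a \<Rightarrow> 'a vec \<Rightarrow> 'a vec" where
  "scale_at n i \<alpha> x = vec n (\<lambda>j. if j = i then \<alpha> * x $ j else x $ j)"

lemma herm_scale_at:
  assumes "i < n"
  shows "herm n (scale_at n i \<alpha> x) (scale_at n i \<alpha> y) =
    herm n x y + (\<alpha> ^ (q + 1) - 1) * (x $ i * (y $ i) ^ q)"
proof -
  have "herm n (scale_at n i \<alpha> x) (scale_at n i \<alpha> y) =
      (\<Sum>j<n. x $ j * (y $ j) ^ q + (if j = i then (\<alpha> ^ (q + 1) - 1) * (x $ i * (y $ i) ^ q) else 0))"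
    unfolding herm_def
    by (intro sum.cong) (auto simp: scale_at_def power_mult_distrib algebra_simps)
  then show ?thesis
    using assms by (simp add: sum.distrib herm_def)
qed

text \<open>With \<open>\<lambda> = \<alpha>\<^sup>q\<^sup>+\<^sup>1 - 1 \<noteq> 0\<close>, pulling the form back along the scaling adds
  \<open>\<lambda> x\<^sub>i y\<^sub>i\<^sup>q\<close>. Pairing a radical vector \<open>x\<close> with a hull vector that is nonzero at
  \<open>i\<close> forces \<open>x\<^sub>i = 0\<close>, after which the perturbation is invisible.\<close>

lemma hull_scale_at:
  assumes C: "lin_closed n C" and D: "lin_closed n (scale_at n i \<alpha> ` C)" and i: "i < n"
    and \<alpha>: "\<alpha> ^ (q + 1) \<noteq> 1"
    and x0: "x0 \<in> herm_hull q n C" "x0 $ i \<noteq> 0"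
  shows "herm_hull q n (scale_at n i \<alpha> ` C) = {x \<in> herm_hull q n C. x $ i = 0}"
proof (intro equalityI subsetI)
  have fix0: "scale_at n i \<alpha> x = x" if "x \<in> carrier_vec n" "x $ i = 0" for x
    using that by (auto simp: scale_at_def)
  {
    fix x assume "x \<in> {x \<in> herm_hull q n C. x $ i = 0}"
    then have x: "x \<in> herm_hull q n C" "x $ i = 0" by auto
    note xs = hull_memD[OF x(1)]
    show "x \<in> herm_hull q n (scale_at n i \<alpha> ` C)"
    proof (rule hull_memI[OF D])
      show "x \<in> scale_at n i \<alpha> ` C"
        using fix0[OF xs(2) x(2)] xs(1) by force
      fix z assume "z \<in> scale_at n i \<alpha> ` C"
      then obtain y where y: "y \<in> C" "z = scale_at n i \<alpha> y" by auto
      show "herm n z x = 0"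
        using herm_scale_at[OF i, of \<alpha> y x] fix0[OF xs(2) x(2)] xs(3)[OF y(1)] x(2) y(2)
        by (simp add: power_0_left)
    qed
  }
  {
    fix z assume z: "z \<in> herm_hull q n (scale_at n i \<alpha> ` C)"
    then obtain x where x: "x \<in> C" "z = scale_at n i \<alpha> x"
      using hull_memD(1) by blast
    have eq: "herm n y x + (\<alpha> ^ (q + 1) - 1) * (y $ i * (x $ i) ^ q) = 0" if "y \<in> C" for y
      using hull_memD(3)[OF z, of "scale_at n i \<alpha> y"] that herm_scale_at[OF i] x(2) by simp
    have "x $ i = 0"
      using eq[OF hull_memD(1)[OF x0(1)]] hull_memD(4)[OF x0(1) x(1)] x0(2) \<alpha> by simp
    moreover have "x \<in> herm_hull q n C"
      using eq \<open>x $ i = 0\<close> x(1) by (intro hull_memI[OF C]) (auto simp: power_0_left)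
    ultimately show "z \<in> {x \<in> herm_hull q n C. x $ i = 0}"
      using fix0 x lin_closedD(1)[OF C] by auto
  }
qed

text \<open>Used for two functionals: a coordinate, when the hull is to shrink, and the pairing with
  w, when it is to be kept.\<close>

lemma card_hyperplane_section:
  fixes V :: "'a vec set"
  assumes V: "lin_closed n V" and f: "\<And>x y. x \<in> V \<Longrightarrow> y \<in> V \<Longrightarrow> f x = f y \<longleftrightarrow> f (x - y) = (0 :: 'a)"
  shows "card V = card (f ` V) * card {x \<in> V. f x = 0}"
  by (rule card_eq_card_image_times_kernel[OF V]) (use f lin_closed_diff[OF V] in auto)

text \<open>Multiples of \<open>x0\<close> take every value at coordinate i, so the coordinate map
  is onto the field and its kernel is smaller by exactly one factor of the field size.\<close>

lemma code_dim_section: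
  fixes V :: "'a vec set"
  assumes V: "lin_closed n V" and W: "lin_closed n {x \<in> V. x $ i = 0}" and i: "i < n"
    and x0: "x0 \<in> V" "x0 $ i \<noteq> 0"
  shows "code_dim n V = Suc (code_dim n {x \<in> V. x $ i = 0})"
proof -
  have sub: "x \<in> carrier_vec n" if "x \<in> V" for x
    using lin_closedD(1)[OF V] that by auto
  have "(\<lambda>x. x $ i) ` V = UNIV"
  proof (intro equalityI subsetI)
    fix c
    have "c = ((c / x0 $ i) \<cdot>\<^sub>v x0) $ i" "(c / x0 $ i) \<cdot>\<^sub>v x0 \<in> V"
      using sub[OF x0(1)] i x0 lin_closedD(4)[OF V] by auto
    then show "c \<in> (\<lambda>x. x $ i) ` V"
      by blast
  qed simp
  moreover have "card V = card ((\<lambda>x. x $ i) ` V) * card {x \<in> V. x $ i = 0}"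
    by (rule card_hyperplane_section[OF V]) (use carrier_vecD[OF sub] i in auto)
  ultimately have "card (UNIV :: 'a set) ^ code_dim n V =
      card (UNIV :: 'a set) ^ Suc (code_dim n {x \<in> V. x $ i = 0})"
    using card_subspace_eq[OF V] card_subspace_eq[OF W] by simp
  then show ?thesis
    using power_inject_exp[OF one_less_card_field[where ?'a = 'a]] by blast
qed

section \<open>GRS codes: dimension, hull descent and extension\<close>

lemma lin_closed_GRS: "lin_closed n (GRS n k a v)"
  unfolding lin_closed_def
proof (intro conjI ballI allI)
  show "GRS n k a v \<subseteq> carrier_vec n"
    by (auto simp: GRS_def)
  show "0\<^sub>v n \<in> GRS n k a v"
    unfolding GRS_def by (intro CollectI exI[of _ 0]) auto
  fix x assume "x \<in> GRS n k a v"
  then obtain f where f: "degree f \<le> k - 1" "x = vec n (\<lambda>j. v $ j * poly f (a $ j))"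
    by (auto simp: GRS_def)
  show "c \<cdot>\<^sub>v x \<in> GRS n k a v" for c
    unfolding GRS_def
    by (intro CollectI exI[of _ "Polynomial.smult c f"]) (use f degree_smult_le[of c f] in auto)
  fix y assume "y \<in> GRS n k a v"
  then obtain g where g: "degree g \<le> k - 1" "y = vec n (\<lambda>j. v $ j * poly g (a $ j))"
    by (auto simp: GRS_def)
  show "x + y \<in> GRS n k a v"
    unfolding GRS_def
    by (intro CollectI exI[of _ "f + g"]) (use f g in \<open>auto intro: degree_add_le simp: algebra_simps\<close>)
qed

text \<open>The multipliers are nonzero, so a nonzero difference would have the n distinct
  evaluation points as roots, while its degree is at most k - 1 < n.\<close>

lemma GRS_eval_inj:
  assumes "GRS_params n a v" "k \<le> n" "1 \<le> k" "degree f \<le> k - 1" "degree g \<le> k - 1"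
    and eq: "vec n (\<lambda>j. v $ j * poly f (a $ j)) = vec n (\<lambda>j. v $ j * poly g (a $ j))"
  shows "f = g"
proof (rule ccontr)
  assume "f \<noteq> g"
  have "v $ j * poly f (a $ j) = v $ j * poly g (a $ j)" if "j < n" for j
    using arg_cong[OF eq, of "\<lambda>x. x $ j"] that by simp
  then have "(\<lambda>j. a $ j) ` {..<n} \<subseteq> {x. poly (f - g) x = 0}"
    using assms(1) by (auto simp: GRS_params_def)
  moreover have "card ((\<lambda>j. a $ j) ` {..<n}) = n"
    using assms(1) by (simp add: GRS_params_def card_image)
  ultimately have "n \<le> card {x. poly (f - g) x = 0}"
    using card_mono[OF poly_roots_finite[of "f - g"], of "(\<lambda>j. a $ j) ` {..<n}"] \<open>f \<noteq> g\<close> by simp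
  moreover have "card {x. poly (f - g) x = 0} \<le> degree (f - g)"
    using \<open>f \<noteq> g\<close> by (intro card_poly_roots_bound) auto
  moreover have "degree (f - g) \<le> k - 1"
    using assms(4,5) by (rule degree_diff_le)
  ultimately have "n \<le> k - 1"
    by linarith
  then show False
    using assms(2,3) by simp
qed

lemma code_dim_GRS:
  fixes a v :: "'a vec"
  assumes "GRS_params n a v" "1 \<le> k" "k \<le> n"
  shows "code_dim n (GRS n k a v) = k"
proof -
  have "GRS n k a v = (\<lambda>f. vec n (\<lambda>j. v $ j * poly f (a $ j))) ` {f. degree f \<le> k - 1}"
    by (auto simp: GRS_def)
  moreover have "inj_on (\<lambda>f. vec n (\<lambda>j. v $ j * poly f (a $ j))) {f. degree f \<le> k - 1}"
    using GRS_eval_inj[OF assms(1,3,2)] by (auto intro!: inj_onI)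
  ultimately have "card (GRS n k a v) = card (UNIV :: 'a set) ^ k"
    using assms(2) card_poly_degree_le[of "k - 1", where ?'a = 'a] by (simp add: card_image del: One_nat_def)
  then show ?thesis
    using card_subspace_eq[OF lin_closed_GRS, of n k a v] power_inject_exp[OF one_less_card_field[where ?'a = 'a]]
    by metis
qed

lemma GRS_hull_descent_step:
  fixes a v :: "'a vec"
  assumes P: "GRS_params n a v"
    and dim: "code_dim n (herm_hull q n (GRS n k a v)) = Suc h"
  shows "\<exists>v'. GRS_params n a v' \<and> code_dim n (herm_hull q n (GRS n k a v')) = h"
proof -
  define C where "C = GRS n k a v"
  have C: "lin_closed n C"
    unfolding C_def by (rule lin_closed_GRS)
  note H = lin_closed_hull[OF C]
  \<comment> \<open>Positive dimension means more than one vector, which supplies a nonzero hull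
    vector and a coordinate where it does not vanish.\<close>
  have "1 < card (UNIV :: 'a set) ^ Suc h"
    using one_less_card_field by (rule one_less_power) simp
  then have "1 < card (herm_hull q n C)"
    using card_subspace_eq[OF H] dim by (simp only: C_def)
  then have "herm_hull q n C \<noteq> {0\<^sub>v n}"
    by auto
  then obtain x0 where x0: "x0 \<in> herm_hull q n C" "x0 \<noteq> 0\<^sub>v n"
    using lin_closedD(2)[OF H] by blast
  then obtain i where i: "i < n" "x0 $ i \<noteq> 0"
    using hull_memD(2)[OF x0(1)] by (auto simp: vec_eq_iff)
  obtain \<alpha> :: 'a where \<alpha>: "\<alpha> \<noteq> 0" "\<alpha> ^ (q + 1) \<noteq> 1"
    using exists_norm_ne_1 by blast
  \<comment> \<open>Scaling coordinate i of every codeword amounts to scaling the single multiplier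
    \<open>v $ i\<close>, so the scaled code is again GRS with the same evaluation points.\<close>
  define v' where "v' = scale_at n i \<alpha> v"
  have P': "GRS_params n a v'"
    using P \<alpha>(1) by (auto simp: GRS_params_def v'_def scale_at_def)
  have "scale_at n i \<alpha> (vec n (\<lambda>j. v $ j * poly f (a $ j))) = vec n (\<lambda>j. v' $ j * poly f (a $ j))" for f
    by (auto simp: scale_at_def v'_def)
  then have D: "GRS n k a v' = scale_at n i \<alpha> ` C"
    unfolding C_def GRS_def by (simp add: setcompr_eq_image image_image)
  have hull: "herm_hull q n (GRS n k a v') = {x \<in> herm_hull q n C. x $ i = 0}"
    unfolding D using hull_scale_at[OF C _ i(1) \<alpha>(2) x0(1) i(2)] lin_closed_GRS D by metis
  have "code_dim n (herm_hull q n C) = Suc (code_dim n (herm_hull q n (GRS n k a v')))"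
    unfolding hull
    using code_dim_section[OF H _ i(1) x0(1) i(2)] lin_closed_hull[OF lin_closed_GRS] hull by metis
  then show ?thesis
    using P' dim by (auto simp: C_def)
qed

lemma GRS_hull_descent:
  fixes a v :: "'a vec"
  assumes "GRS_params n a v" "s \<le> code_dim n (herm_hull q n (GRS n k a v))"
  shows "\<exists>v'. GRS_params n a v' \<and> code_dim n (herm_hull q n (GRS n k a v')) = s"
  using assms
\<comment> \<open>The induction runs on the excess dimension with v arbitrary, because each descent
  step changes the multipliers.\<close>
proof (induction "code_dim n (herm_hull q n (GRS n k a v)) - s" arbitrary: v)
  case 0
  then show ?case by auto
next
  case (Suc d)
  then obtain h where h: "code_dim n (herm_hull q n (GRS n k a v)) = Suc h" "s \<le> h" "d = h - s"
    by (cases "code_dim n (herm_hull q n (GRS n k a v))") auto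
  obtain v' where "GRS_params n a v'" "code_dim n (herm_hull q n (GRS n k a v')) = h"
    using GRS_hull_descent_step[OF Suc.prems(1) h(1)] by blast
  then show ?case
    using Suc.hyps(1) h by metis
qed

text \<open>For exponent k the multipliers stay and w is the evaluation of the monomial of degree k.
  For exponent -1, dividing the multipliers by the evaluation points shifts all exponents: an old
  polynomial f becomes x f, and w is the evaluation of the constant 1.\<close>

lemma GRS_extension:
  fixes a v w :: "'a vec"
  assumes P: "GRS_params n a v" and k: "1 \<le> k"
    and w: "w = GRS_row n a v (int k) \<or> (\<forall>j<n. a $ j \<noteq> 0) \<and> w = GRS_row n a v (- 1)"
  shows "\<exists>v'. GRS_params n a v' \<and> GRS n k a v \<subseteq> GRS n (k + 1) a v' \<and> w \<in> GRS n (k + 1) a v' \<and>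
    (\<forall>x\<in>GRS n (k + 1) a v'. \<exists>c\<in>GRS n k a v. \<exists>t. x = c + t \<cdot>\<^sub>v w)"
  using w
proof (elim disjE conjE)
  assume w: "w = GRS_row n a v (int k)"
  show ?thesis
  proof (intro exI[of _ v] conjI ballI)
    show "GRS_params n a v" by fact
    show "GRS n k a v \<subseteq> GRS n (k + 1) a v"
      using k by (fastforce simp: GRS_def)
    show "w \<in> GRS n (k + 1) a v"
      unfolding GRS_def w GRS_row_def
      by (intro CollectI exI[of _ "Polynomial.monom 1 k"]) (auto simp: poly_monom degree_monom_eq)
    fix x assume "x \<in> GRS n (k + 1) a v"
    then obtain f where f: "degree f \<le> k" "x = vec n (\<lambda>j. v $ j * poly f (a $ j))"
      by (auto simp: GRS_def)
    \<comment> \<open>Removing the term of degree k leaves a polynomial for the old code; the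
      removed term evaluates to a multiple of w.\<close>
    define g where "g = f - Polynomial.monom (coeff f k) k"
    have "degree g \<le> k - 1"
      using f(1) k by (intro degree_le) (auto simp: g_def coeff_eq_0)
    then have "vec n (\<lambda>j. v $ j * poly g (a $ j)) \<in> GRS n k a v"
      by (auto simp: GRS_def)
    moreover have "x = vec n (\<lambda>j. v $ j * poly g (a $ j)) + coeff f k \<cdot>\<^sub>v w"
      unfolding f w GRS_row_def by (intro eq_vecI) (auto simp: g_def poly_monom algebra_simps)
    ultimately show "\<exists>c\<in>GRS n k a v. \<exists>t. x = c + t \<cdot>\<^sub>v w"
      by blast
  qed
next
  assume a: "\<forall>j<n. a $ j \<noteq> 0" and w: "w = GRS_row n a v (- 1)"
  define v' where "v' = vec n (\<lambda>j. v $ j / a $ j)"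
  show ?thesis
  proof (intro exI[of _ v'] conjI ballI subsetI)
    show "GRS_params n a v'"
      using P a by (auto simp: GRS_params_def v'_def)
    show "w \<in> GRS n (k + 1) a v'"
      unfolding GRS_def w GRS_row_def
      by (intro CollectI exI[of _ 1]) (auto simp: v'_def power_int_minus field_simps)
    {
      fix x assume "x \<in> GRS n k a v"
      then obtain f where f: "degree f \<le> k - 1" "x = vec n (\<lambda>j. v $ j * poly f (a $ j))"
        by (auto simp: GRS_def)
      then show "x \<in> GRS n (k + 1) a v'"
        unfolding GRS_def using a k
        by (intro CollectI exI[of _ "pCons 0 f"]) (auto simp: v'_def degree_pCons_eq_if)
    }
    fix x assume "x \<in> GRS n (k + 1) a v'"
    then obtain f where f: "degree f \<le> k" "x = vec n (\<lambda>j. v' $ j * poly f (a $ j))"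
      by (auto simp: GRS_def)
    \<comment> \<open>The constant coefficient t contributes the multiple of w; the remaining part x
      g cancels the division by \<open>a $ j\<close> and gives an old codeword.\<close>
    obtain t g where g: "f = pCons t g"
      by (cases f)
    have "degree g \<le> k - 1"
      using f(1) k g by (auto split: if_splits)
    then have "vec n (\<lambda>j. v $ j * poly g (a $ j)) \<in> GRS n k a v"
      by (auto simp: GRS_def)
    moreover have "x = vec n (\<lambda>j. v $ j * poly g (a $ j)) + t \<cdot>\<^sub>v w"
      unfolding f w GRS_row_def using a
      by (intro eq_vecI) (auto simp: g v'_def power_int_minus field_simps)
    ultimately show "\<exists>c\<in>GRS n k a v. \<exists>t. x = c + t \<cdot>\<^sub>v w"
      by blast
  qed
qed

section \<open>The matrix S and codewords from coefficient vectors\<close>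

definition herm_mat :: "'a vec \<Rightarrow> nat \<Rightarrow> 'a mat" where
  "herm_mat w n = herm_sq q w \<cdot>\<^sub>m 1\<^sub>m n - hdagger q (mat_of_row w) * mat_of_row w"

lemma herm_mat_carrier [simp]:
  "w \<in> carrier_vec n \<Longrightarrow> herm_mat w n \<in> carrier_mat n n"
  by (auto simp: herm_mat_def hdagger_def mat_of_row_def)

lemma herm_mat_index:
  assumes "w \<in> carrier_vec n" "i < n" "j < n"
  shows "herm_mat w n $$ (i, j) = (if i = j then herm n w w else 0) - (w $ i) ^ q * w $ j"
  using assms herm_sq_eq[OF assms(1)]
  by (simp add: herm_mat_def hdagger_def mat_of_row_def scalar_prod_def)

text \<open>If z is the entrywise conjugate of x, the result is the entrywise conjugate of
  \<open>herm n w w\<close> times x minus \<open>herm n x w\<close> times w. So for anisotropic w,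
  up to conjugation and a scalar, S projects away from w.\<close>

lemma herm_mat_mult_vec:
  assumes w: "w \<in> carrier_vec n" and z: "z \<in> carrier_vec n" and j: "j < n"
  shows "(herm_mat w n *\<^sub>v z) $ j = herm n w w * z $ j - (w $ j) ^ q * (\<Sum>i<n. w $ i * z $ i)"
proof -
  have "(herm_mat w n *\<^sub>v z) $ j = (\<Sum>i<n. herm_mat w n $$ (j, i) * z $ i)"
    using herm_mat_carrier[OF w] z j
    by (auto simp: scalar_prod_def lessThan_atLeast0 intro!: sum.cong)
  also have "\<dots> = (\<Sum>i<n. (if j = i then herm n w w * z $ i else 0) - (w $ j) ^ q * (w $ i * z $ i))"
    by (rule sum.cong) (use w j in \<open>auto simp: herm_mat_index algebra_simps\<close>)
  finally show ?thesis
    using j by (simp add: sum_subtractf sum_distrib_left)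
qed

text \<open>The kernel is the line spanned by the conjugate of w: a kernel vector is a multiple of
  it after division by the nonzero \<open>herm n w w\<close>, and conversely its multiples are
  annihilated. Counting the kernel gives the rank.\<close>

lemma rank_herm_mat:
  assumes w: "w \<in> carrier_vec n" and "herm_sq q w \<noteq> 0"
  shows "vec_space.rank n (herm_mat w n) = n - 1"
proof -
  define h where "h = herm n w w"
  have h0: "h \<noteq> 0"
    using assms herm_sq_eq by (simp add: h_def)
  define e where "e = (\<lambda>c. vec n (\<lambda>j. c * (w $ j) ^ q))"
  have e: "e c \<in> carrier_vec n" for c
    by (simp add: e_def)
  have ker: "z \<in> mat_kernel (herm_mat w n) \<longleftrightarrow>
      z \<in> carrier_vec n \<and> (\<forall>j<n. h * z $ j = (w $ j) ^ q * (\<Sum>i<n. w $ i * z $ i))" for z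
    using herm_mat_carrier[OF w] herm_mat_mult_vec[OF w]
    by (auto simp: mat_kernel[OF herm_mat_carrier[OF w]] vec_eq_iff h_def)
  have "mat_kernel (herm_mat w n) = range e"
  proof (intro equalityI subsetI)
    fix z assume z: "z \<in> mat_kernel (herm_mat w n)"
    then have "z = e ((\<Sum>i<n. w $ i * z $ i) / h)"
      unfolding ker e_def using h0 by (intro eq_vecI) (auto simp: field_simps)
    then show "z \<in> range e"
      by blast
  next
    fix z assume "z \<in> range e"
    then obtain c where z: "z = e c" by blast
    have "(\<Sum>i<n. w $ i * e c $ i) = c * h"
      by (simp add: e_def h_def herm_def sum_distrib_left mult_ac)
    then show "z \<in> mat_kernel (herm_mat w n)"
      unfolding ker z using e by (simp add: e_def mult_ac)
  qed
  moreover have "inj e"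
  proof
    fix c d assume "e c = e d"
    have "w \<noteq> 0\<^sub>v n"
      using h0 by (auto simp: h_def herm_def)
    then obtain j where j: "j < n" "w $ j \<noteq> 0"
      using w by (auto simp: vec_eq_iff)
    then show "c = d"
      using arg_cong[OF \<open>e c = e d\<close>, of "\<lambda>x. x $ j"] by (simp add: e_def)
  qed
  ultimately have "card (mat_kernel (herm_mat w n)) = card (UNIV :: 'a set)"
    by (simp add: card_image)
  then have "card (UNIV :: 'a set) ^ Suc (vec_space.rank n (herm_mat w n)) = card (UNIV :: 'a set) ^ n"
    using card_mat_kernel[OF herm_mat_carrier[OF w]] by simp
  then have "Suc (vec_space.rank n (herm_mat w n)) = n"
    using power_inject_exp[OF one_less_card_field[where ?'a = 'a]] by blast
  then show ?thesis
    by simp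
qed

text \<open>The coefficients are conjugated so that the conjugate transpose of the generator matrix,
  applied to y, is the entrywise conjugate of this codeword.\<close>

definition codeword :: "nat \<Rightarrow> nat \<Rightarrow> 'a vec \<Rightarrow> 'a vec \<Rightarrow> 'a vec \<Rightarrow> 'a vec" where
  "codeword n k a v y = vec n (\<lambda>j. v $ j * poly (\<Sum>i<k. Polynomial.monom ((y $ i) ^ q) i) (a $ j))"

lemma degree_codeword_poly: "degree (\<Sum>i<k. Polynomial.monom (c i) i) \<le> k - 1"
  by (rule degree_sum_le) (auto intro: order.trans[OF degree_monom_le])

lemma codeword_mem: "codeword n k a v y \<in> GRS n k a v"
  unfolding GRS_def codeword_def
  by (intro CollectI exI[of _ "\<Sum>i<k. Polynomial.monom ((y $ i) ^ q) i"] conjI refl degree_codeword_poly)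

lemma codeword_inj:
  fixes a v :: "'a vec"
  assumes "GRS_params n a v" "k \<le> n" "1 \<le> k"
    and y: "y \<in> carrier_vec k" "y' \<in> carrier_vec k"
    and eq: "codeword n k a v y = codeword n k a v y'"
  shows "y = y'"
proof (rule eq_vecI)
  have poly_eq: "(\<Sum>i<k. Polynomial.monom ((y $ i) ^ q) i) = (\<Sum>i<k. Polynomial.monom ((y' $ i) ^ q) i)"
    by (rule GRS_eval_inj[OF assms(1-3) degree_codeword_poly degree_codeword_poly])
      (use eq in \<open>simp add: codeword_def\<close>)
  fix i assume "i < dim_vec y'"
  then have "i < k"
    using y by simp
  then have "(y $ i) ^ q = (y' $ i) ^ q"
    using arg_cong[OF poly_eq, of "\<lambda>p. coeff p i"] by (simp add: coeff_sum)
  then show "y $ i = y' $ i"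
    by (simp add: conj_inj)
qed (use y in simp)

lemma hdagger_gen_mat_mult_vec:
  assumes y: "y \<in> carrier_vec k" and j: "j < n"
  shows "(hdagger q (GRS_gen_mat n k a v) *\<^sub>v y) $ j = (codeword n k a v y $ j) ^ q"
proof -
  let ?G = "GRS_gen_mat n k a v"
  note G = carrier_matD[OF GRS_gen_mat_carrier[of n k a v]]
  have "(hdagger q ?G *\<^sub>v y) $ j = (\<Sum>i<k. (?G $$ (i, j)) ^ q * y $ i)"
    using y j G by (auto simp: hdagger_def scalar_prod_def lessThan_atLeast0 intro!: sum.cong)
  \<comment> \<open>Writing \<open>y $ i\<close> as its double conjugate puts each summand entirely
    under a q-th power, which then leaves the sum by additivity.\<close>
  also have "\<dots> = (\<Sum>i<k. (v $ j * (a $ j) ^ i * (y $ i) ^ q) ^ q)"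
    by (rule sum.cong) (use j in \<open>auto simp: GRS_gen_mat_index power_mult_distrib\<close>)
  also have "\<dots> = (\<Sum>i<k. v $ j * (a $ j) ^ i * (y $ i) ^ q) ^ q"
    by (rule conj_sum[symmetric])
  also have "(\<Sum>i<k. v $ j * (a $ j) ^ i * (y $ i) ^ q) = codeword n k a v y $ j"
    using j by (simp add: codeword_def poly_sum poly_monom sum_distrib_left mult_ac)
  finally show ?thesis .
qed

text \<open>The coefficients of f express a codeword as a combination of the rows. The pairing is
  bilinear, without conjugation, because it will be applied to a z that is already a
  conjugate.\<close>

lemma GRS_orthogonal_if_rows_orthogonal:
  assumes rows: "GRS_gen_mat n k a v *\<^sub>v z = 0\<^sub>v k" and z: "z \<in> carrier_vec n"
    and k: "1 \<le> k" and c: "c \<in> GRS n k a v"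
  shows "(\<Sum>j<n. c $ j * z $ j) = 0"
proof -
  let ?G = "GRS_gen_mat n k a v"
  note G = carrier_matD[OF GRS_gen_mat_carrier[of n k a v]]
  obtain f where f: "degree f \<le> k - 1" "c = vec n (\<lambda>j. v $ j * poly f (a $ j))"
    using c by (auto simp: GRS_def)
  have row: "(\<Sum>j<n. ?G $$ (i, j) * z $ j) = 0" if i: "i < k" for i
  proof -
    have "(\<Sum>j<n. ?G $$ (i, j) * z $ j) = (?G *\<^sub>v z) $ i"
      using G z i by (auto simp: scalar_prod_def lessThan_atLeast0 intro!: sum.cong)
    then show ?thesis
      using rows i by simp
  qed
  have "(\<Sum>j<n. c $ j * z $ j) = (\<Sum>j<n. \<Sum>i<k. coeff f i * (?G $$ (i, j) * z $ j))"
    by (rule sum.cong)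
      (auto simp: f(2) poly_eq_sum_lessThan[OF f(1) k] GRS_gen_mat_index sum_distrib_left sum_distrib_right mult_ac)
  also have "\<dots> = (\<Sum>i<k. coeff f i * (\<Sum>j<n. ?G $$ (i, j) * z $ j))"
    by (subst sum.swap) (simp add: sum_distrib_left)
  also have "\<dots> = 0"
    by (simp add: row)
  finally show ?thesis .
qed

end

section \<open>Adjoining a vector to a code\<close>

text \<open>Here C' is the direct sum of C and the line through w. The GRS structure enters only in
  the anisotropic bound.\<close>

locale code_extension = hermitian_space q ty
  for q :: nat and ty :: "'a::{field,finite} itself" +
  fixes n :: nat and C C' :: "'a vec set" and w :: "'a vec"
  assumes C: "lin_closed n C" and C': "lin_closed n C'" and C_sub: "C \<subseteq> C'"
    and w: "w \<in> C'" "w \<notin> C"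
    and decomp: "x \<in> C' \<Longrightarrow> \<exists>c\<in>C. \<exists>t. x = c + t \<cdot>\<^sub>v w"
begin

lemma carrier [simp]: "x \<in> C' \<Longrightarrow> x \<in> carrier_vec n" "x \<in> C \<Longrightarrow> x \<in> carrier_vec n" "w \<in> carrier_vec n"
  using lin_closedD(1)[OF C'] C_sub w(1) by auto

lemma decomp_unique:
  assumes c: "c \<in> C" "c' \<in> C" and eq: "c + t \<cdot>\<^sub>v w = c' + t' \<cdot>\<^sub>v w"
  shows "c = c' \<and> t = t'"
proof -
  have ix: "c $ j + t * w $ j = c' $ j + t' * w $ j" if "j < n" for j
    using arg_cong[OF eq, of "\<lambda>x. x $ j"] that c carrier_vecD[OF carrier(3)] by simp
  have t: "t = t'"
  proof (rule ccontr)
    assume "t \<noteq> t'"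
    \<comment> \<open>Different multiples of w would allow solving for w inside C.\<close>
    have "(1 / (t - t')) \<cdot>\<^sub>v (c' - c) \<in> C"
      by (intro lin_closedD(4)[OF C] lin_closed_diff[OF C] c)
    also have "(1 / (t - t')) \<cdot>\<^sub>v (c' - c) = w"
    proof (rule eq_vecI)
      fix j assume "j < dim_vec w"
      then have j: "j < n"
        using carrier_vecD[OF carrier(3)] by simp
      have "c' $ j - c $ j = (t - t') * w $ j"
        using ix[OF j] by (simp add: algebra_simps)
      then show "((1 / (t - t')) \<cdot>\<^sub>v (c' - c)) $ j = w $ j"
        using j \<open>t \<noteq> t'\<close> carrier_vecD[OF carrier(2)[OF c(1)]] carrier_vecD[OF carrier(2)[OF c(2)]] by simp
    qed (simp only: index_smult_vec index_minus_vec carrier_vecD[OF carrier(3)] carrier_vecD[OF carrier(2)[OF c(1)]])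
    finally show False
      using w(2) by simp
  qed
  have "c = c'"
    using ix carrier_vecD[OF carrier(2)[OF c(1)]] carrier_vecD[OF carrier(2)[OF c(2)]]
    by (intro eq_vecI) (simp_all add: t)
  with t show ?thesis by simp
qed

text \<open>C and w span C', and the form is linear in its first argument, so orthogonality need
  only be tested on them.\<close>

lemma ext_hull_memI:
  assumes "x \<in> C'" "\<And>c. c \<in> C \<Longrightarrow> herm n c x = 0" "herm n w x = 0"
  shows "x \<in> herm_hull q n C'"
proof (rule hull_memI[OF C' assms(1)])
  fix y assume "y \<in> C'"
  then obtain c t where "c \<in> C" "y = c + t \<cdot>\<^sub>v w"
    using decomp by blast
  then show "herm n y x = 0"
    using assms(2,3) by (simp add: herm_add_left herm_smult_left)
qed

lemma ext_combo_mem: "c \<in> C \<Longrightarrow> c + t \<cdot>\<^sub>v w \<in> C'"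
  using C_sub w(1) by (intro lin_closedD(3,4)[OF C']) auto

lemma hull_dim_ext_geI:
  assumes "card (UNIV :: 'a set) ^ m \<le> card U" "inj_on f U" "f ` U \<subseteq> herm_hull q n C'"
  shows "m \<le> code_dim n (herm_hull q n C')"
proof (rule card_le_imp_le_code_dim[OF lin_closed_hull[OF C']])
  show "card (UNIV :: 'a set) ^ m \<le> card (herm_hull q n C')"
    using assms(1) card_inj_on_le[OF assms(2,3) lin_closed_finite[OF lin_closed_hull[OF C']]] by simp
qed

text \<open>Here w is orthogonal to C and to itself, so the old hull and w together lie in the new
  hull; as w is outside C, this gains one dimension.\<close>

lemma hull_dim_isotropic:
  assumes "w \<in> herm_dual q n C" "herm_sq q w = 0"
  shows "code_dim n (herm_hull q n C) + 1 \<le> code_dim n (herm_hull q n C')"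
proof (rule hull_dim_ext_geI)
  let ?U = "herm_hull q n C \<times> (UNIV :: 'a set)"
  let ?f = "\<lambda>(h, t). h + t \<cdot>\<^sub>v w"
  show "card (UNIV :: 'a set) ^ (code_dim n (herm_hull q n C) + 1) \<le> card ?U"
    by (simp add: card_cartesian_product card_subspace_eq[OF lin_closed_hull[OF C]])
  show "inj_on ?f ?U"
  proof (rule inj_onI)
    fix x y assume "x \<in> ?U" "y \<in> ?U" "?f x = ?f y"
    then show "x = y"
      using decomp_unique[of "fst x" "fst y" "snd x" "snd y", OF hull_memD(1) hull_memD(1)]
      by (simp add: split_beta prod_eq_iff mem_Times_iff)
  qed
  have perp: "herm n c w = 0" if "c \<in> C" for c
    using assms(1) that by (auto simp: herm_dual_eq)
  have wh: "herm n w h = 0" if "h \<in> C" for h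
    using herm_conj[of n h w] perp[OF that] by (simp add: power_0_left)
  have ww: "herm n w w = 0"
    using assms(2) herm_sq_eq[OF carrier(3)] by simp
  have "h + t \<cdot>\<^sub>v w \<in> herm_hull q n C'" if h: "h \<in> herm_hull q n C" for h t
    using ext_combo_mem[OF hull_memD(1)[OF h]] hull_memD[OF h] perp wh ww
    by (intro ext_hull_memI) (auto simp: herm_add_right herm_smult_right)
  then show "?f ` ?U \<subseteq> herm_hull q n C'"
    by auto
qed

text \<open>The old hull is orthogonal to C and, by assumption, to w, so it survives whole.\<close>

lemma hull_dim_perp:
  assumes "w \<in> herm_dual q n (herm_hull q n C)"
  shows "code_dim n (herm_hull q n C) \<le> code_dim n (herm_hull q n C')"
proof (rule hull_dim_ext_geI)
  show "card (UNIV :: 'a set) ^ code_dim n (herm_hull q n C) \<le> card (herm_hull q n C)"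
    by (simp add: card_subspace_eq[OF lin_closed_hull[OF C]])
  show "inj_on (\<lambda>x. x) (herm_hull q n C)"
    by simp
  have "h \<in> herm_hull q n C'" if h: "h \<in> herm_hull q n C" for h
  proof (rule ext_hull_memI)
    show "h \<in> C'" "\<And>c. c \<in> C \<Longrightarrow> herm n c h = 0"
      using hull_memD[OF h] C_sub by auto
    have "herm n h w = 0"
      using assms h by (auto simp: herm_dual_eq)
    then show "herm n w h = 0"
      using herm_conj[of n h w] by (simp add: power_0_left)
  qed
  then show "(\<lambda>x. x) ` herm_hull q n C \<subseteq> herm_hull q n C'"
    by auto
qed

text \<open>The old hull vectors orthogonal to w survive. They form the kernel of a functional with
  values in the field, so at most one dimension is lost.\<close>

lemma hull_dim_general:
  assumes "int s \<le> int (code_dim n (herm_hull q n C)) - 1"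
  shows "s \<le> code_dim n (herm_hull q n C')"
proof (rule hull_dim_ext_geI)
  let ?H = "herm_hull q n C"
  let ?K = "{x \<in> ?H. herm n x w = 0}"
  note H = lin_closed_hull[OF C]
  show "inj_on (\<lambda>x. x) ?K"
    by simp
  show "(\<lambda>x. x) ` ?K \<subseteq> herm_hull q n C'"
  proof clarsimp
    fix h assume h: "h \<in> ?H" and hw: "herm n h w = 0"
    show "h \<in> herm_hull q n C'"
    proof (rule ext_hull_memI)
      show "h \<in> C'" "\<And>c. c \<in> C \<Longrightarrow> herm n c h = 0"
        using hull_memD[OF h] C_sub by auto
      show "herm n w h = 0"
        using herm_conj[of n h w] hw by (simp add: power_0_left)
    qed
  qed
  have diff: "herm n x w = herm n y w \<longleftrightarrow> herm n (x - y) w = 0" if "x \<in> ?H" "y \<in> ?H" for x y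
  proof -
    have "herm n (x - y) w = herm n x w - herm n y w"
      using hull_memD(2)[OF that(1)] hull_memD(2)[OF that(2)]
      by (simp add: herm_def algebra_simps sum_subtractf)
    then show ?thesis by simp
  qed
  \<comment> \<open>The integer inequality rules out a zero-dimensional hull, so its dimension has a
    predecessor.\<close>
  obtain m where m: "code_dim n ?H = Suc m" "s \<le> m"
    using assms by (cases "code_dim n ?H") auto
  have "card (UNIV :: 'a set) * card (UNIV :: 'a set) ^ m = card ?H"
    using card_subspace_eq[OF H] m by simp
  also have "\<dots> = card ((\<lambda>x. herm n x w) ` ?H) * card ?K"
    by (rule card_hyperplane_section[OF H]) (use diff in blast)
  also have "\<dots> \<le> card (UNIV :: 'a set) * card ?K"
    by (intro mult_right_mono card_mono) auto
  finally have "card (UNIV :: 'a set) ^ m \<le> card ?K"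
    using one_less_card_field[where ?'a = 'a] by simp
  moreover have "card (UNIV :: 'a set) ^ s \<le> card (UNIV :: 'a set) ^ m"
    using one_less_card_field[where ?'a = 'a] m(2) by (intro power_increasing) auto
  ultimately show "card (UNIV :: 'a set) ^ s \<le> card ?K"
    by linarith
qed

text \<open>A kernel vector \<open>y\<close> of \<open>G S G\<^sup>\<dagger>\<close> yields the codeword \<open>u\<close> with coefficients \<open>y\<^sub>i\<^sup>q\<close>;
  its projection away from \<open>w\<close>, scaled by \<open>w w\<^sup>\<dagger>\<close>, is orthogonal to the extended code.\<close>

lemma hull_dim_anisotropic:
  assumes P: "GRS_params n a v" and k: "1 \<le> k" "k \<le> n" and C_eq: "C = GRS n k a v"
    and ww: "herm_sq q w \<noteq> 0"
    and s: "int s \<le> int k - int (vec_space.rank k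
      (GRS_gen_mat n k a v * herm_mat w n * hdagger q (GRS_gen_mat n k a v)))"
  shows "s \<le> code_dim n (herm_hull q n C')"
proof -
  let ?G = "GRS_gen_mat n k a v" and ?S = "herm_mat w n"
  let ?M = "?G * ?S * hdagger q ?G"
  define u where "u = codeword n k a v"
  define f where "f = (\<lambda>y. herm n w w \<cdot>\<^sub>v u y + (- (herm n w (u y) ^ q)) \<cdot>\<^sub>v w)"
  have ww0: "herm n w w \<noteq> 0"
    using ww herm_sq_eq[OF carrier(3)] by simp
  have wn: "w \<in> carrier_vec n" by simp
  note S = herm_mat_carrier[OF wn]
  have Gd: "hdagger q ?G \<in> carrier_mat n k"
    using GRS_gen_mat_carrier[of n k a v] by (auto simp: hdagger_def)
  have M: "?M \<in> carrier_mat k k"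
    using mult_carrier_mat[OF mult_carrier_mat[OF GRS_gen_mat_carrier S] Gd] .
  have uC: "u y \<in> C" for y
    unfolding u_def C_eq by (rule codeword_mem)
  have un: "u y \<in> carrier_vec n" for y
    using uC by (rule carrier(2))
  have f_mem: "f y \<in> herm_hull q n C'" if y: "y \<in> mat_kernel ?M" for y
  proof (rule ext_hull_memI)
    show "f y \<in> C'"
      unfolding f_def by (intro ext_combo_mem lin_closedD(4)[OF C] uC)
    have neg_conj: "(- x) ^ q = - (x ^ q)" for x :: 'a
      using conj_add[of x "- x"] by (simp add: eq_neg_iff_add_eq_0 add.commute power_0_left)
    have herm_f: "herm n c (f y) = herm n w w * herm n c (u y) - herm n w (u y) * herm n c w" for c
      unfolding f_def
      using un by (simp add: herm_add_right herm_smult_right neg_conj herm_conj[of n w w])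
    show "herm n w (f y) = 0"
      by (simp add: herm_f)
    have yk: "y \<in> carrier_vec k" and My: "?M *\<^sub>v y = 0\<^sub>v k"
      using mat_kernelD[OF M y] by auto
    define z where "z = ?S *\<^sub>v (hdagger q ?G *\<^sub>v y)"
    have dz: "hdagger q ?G *\<^sub>v y \<in> carrier_vec n"
      using Gd yk by simp
    have z: "z \<in> carrier_vec n"
      unfolding z_def by (rule mult_mat_vec_carrier[OF S dz])
    have "?G *\<^sub>v z = ?M *\<^sub>v y"
      unfolding z_def
      by (simp add: assoc_mult_mat_vec[OF GRS_gen_mat_carrier S dz]
          assoc_mult_mat_vec[OF mult_carrier_mat[OF GRS_gen_mat_carrier S] Gd yk])
    then have Gz: "?G *\<^sub>v z = 0\<^sub>v k"
      using My by simp
    \<comment> \<open>As \<open>herm n w w\<close> is its own conjugate, this makes z the entrywise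
      conjugate of \<open>f y\<close>; the plain sum of c against z is therefore
      \<open>herm n c (f y)\<close>.\<close>
    have z_j: "z $ j = herm n w w * (u y $ j) ^ q - (w $ j) ^ q * herm n w (u y)" if "j < n" for j
      unfolding z_def herm_mat_mult_vec[OF wn dz that] herm_def u_def
      using that by (simp add: hdagger_gen_mat_mult_vec[OF yk])
    fix c assume "c \<in> C"
    then have "(\<Sum>j<n. c $ j * z $ j) = 0"
      using GRS_orthogonal_if_rows_orthogonal[OF Gz z k(1)] C_eq by blast
    also have "(\<Sum>j<n. c $ j * z $ j) =
        (\<Sum>j<n. herm n w w * (c $ j * (u y $ j) ^ q) - herm n w (u y) * (c $ j * (w $ j) ^ q))"
      by (rule sum.cong) (auto simp: z_j algebra_simps)
    also have "\<dots> = herm n c (f y)"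
      unfolding herm_f by (simp add: sum_subtractf sum_distrib_left[symmetric] herm_def[of n c])
    finally show "herm n c (f y) = 0" .
  qed
  have f_inj: "inj_on f (mat_kernel ?M)"
  proof (rule inj_onI)
    fix y y' assume y: "y \<in> mat_kernel ?M" and y': "y' \<in> mat_kernel ?M" and eq: "f y = f y'"
    have "herm n w w \<cdot>\<^sub>v u y = herm n w w \<cdot>\<^sub>v u y'"
      \<comment> \<open>The component of \<open>f y\<close> in C is a nonzero multiple of
        \<open>u y\<close>, which in turn determines y.\<close>
      using decomp_unique[OF lin_closedD(4)[OF C uC] lin_closedD(4)[OF C uC] eq[unfolded f_def]] by blast
    then have "(1 / herm n w w) \<cdot>\<^sub>v (herm n w w \<cdot>\<^sub>v u y) = (1 / herm n w w) \<cdot>\<^sub>v (herm n w w \<cdot>\<^sub>v u y')"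
      by simp
    then have "u y = u y'"
      using ww0 by (simp add: smult_smult_assoc)
    then show "y = y'"
      unfolding u_def
      using codeword_inj[OF P k(2,1)] mat_kernelD(1)[OF M y] mat_kernelD(1)[OF M y'] by blast
  qed
  define r where "r = vec_space.rank k ?M"
  have sr: "s + r \<le> k"
    using s unfolding r_def by linarith
  have "card (UNIV :: 'a set) ^ s * card (UNIV :: 'a set) ^ r \<le> card (UNIV :: 'a set) ^ k"
    unfolding power_add[symmetric]
    using one_less_card_field[where ?'a = 'a] sr by (intro power_increasing) auto
  also have "\<dots> = card (mat_kernel ?M) * card (UNIV :: 'a set) ^ r"
    unfolding r_def by (rule card_mat_kernel[OF M, symmetric])
  finally have "card (UNIV :: 'a set) ^ s \<le> card (mat_kernel ?M)"
    using one_less_card_field[where ?'a = 'a] by simp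
  then show ?thesis
    by (rule hull_dim_ext_geI[OF _ f_inj]) (use f_mem in blast)
qed

end

theorem proposition2:
  fixes q n k l :: nat
    and a v w :: "'a::{field,finite} vec"
    and C :: "'a vec set"
    and G S :: "'a mat"
  assumes "primepow q" and "q > 2" and "card (UNIV :: 'a set) = q ^ 2"
    and "GRS_params n a v"
    and "1 \<le> k" and "k \<le> n - 1"
    and "C = GRS n k a v"
    and "G = GRS_gen_mat n k a v"
    and "code_dim n (herm_hull q n C) = l" and "l \<le> k"
    and "w = GRS_row n a v (int k) \<or>
         n < q ^ 2 \<and> (\<forall>j<n. a $ j \<noteq> 0) \<and> w = GRS_row n a v (- 1)"
    and "S = herm_sq q w \<cdot>\<^sub>m 1\<^sub>m n - hdagger q (mat_of_row w) * mat_of_row w"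
  shows
    "(w \<in> herm_dual q n C \<and> herm_sq q w = 0 \<longrightarrow>
       (\<forall>s. s \<le> l + 1 \<longrightarrow> (\<exists>D :: 'a vec set. is_GRS_code n D \<and> linear_code n (k + 1) D \<and>
          code_dim n (herm_hull q n D) = s))) \<and>
     (w \<notin> herm_dual q n (herm_hull q n C) \<longrightarrow>
       (\<forall>s. int s \<le> int l - 1 \<longrightarrow> (\<exists>D :: 'a vec set. is_GRS_code n D \<and> linear_code n (k + 1) D \<and>
          code_dim n (herm_hull q n D) = s))) \<and>
     (w \<in> herm_dual q n (herm_hull q n C) \<longrightarrow>
       (\<forall>s. s \<le> l \<longrightarrow> (\<exists>D :: 'a vec set. is_GRS_code n D \<and> linear_code n (k + 1) D \<and>
          code_dim n (herm_hull q n D) = s))) \<and>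
     (herm_sq q w \<noteq> 0 \<longrightarrow>
       vec_space.rank n S = n - 1 \<and>
       (\<forall>s. int s \<le> int k - int (vec_space.rank k (G * S * hdagger q G)) \<longrightarrow>
          (\<exists>D :: 'a vec set. is_GRS_code n D \<and> linear_code n (k + 1) D \<and>
             code_dim n (herm_hull q n D) = s)))"
proof -
  interpret hermitian_space q "TYPE('a)"
    by unfold_locales (use assms in auto)
  \<comment> \<open>The natural subtraction n - 1 is harmless: k is at least 1, so n is
    nonzero.\<close>
  have kn: "k + 1 \<le> n" "1 \<le> k + 1" "k \<le> n"
    using assms(5,6) by auto
  have "w = GRS_row n a v (int k) \<or> (\<forall>j<n. a $ j \<noteq> 0) \<and> w = GRS_row n a v (- 1)"
    using assms(11) by blast
  from GRS_extension[OF assms(4,5) this, folded assms(7)]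
  obtain v' where "GRS_params n a v' \<and> C \<subseteq> GRS n (k + 1) a v' \<and> w \<in> GRS n (k + 1) a v' \<and>
      (\<forall>x\<in>GRS n (k + 1) a v'. \<exists>c\<in>C. \<exists>t. x = c + t \<cdot>\<^sub>v w)" ..
  then have v': "GRS_params n a v'" "C \<subseteq> GRS n (k + 1) a v'" "w \<in> GRS n (k + 1) a v'"
      "\<And>x. x \<in> GRS n (k + 1) a v' \<Longrightarrow> \<exists>c\<in>C. \<exists>t. x = c + t \<cdot>\<^sub>v w"
    by simp_all
  define C' where "C' = GRS n (k + 1) a v'"
  note closed = lin_closed_GRS
  \<comment> \<open>If w were in C, the extended code would equal C, although their dimensions are k
    + 1 and k; this needs k + 1 <= n.\<close>
  have "w \<notin> C"
  proof
    assume "w \<in> C"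
    then have "C' \<subseteq> C"
      using v'(4) lin_closedD(3,4)[OF closed[of n k a v, folded assms(7)]] unfolding C'_def by fast
    then have "C' = C"
      using v'(2) by (simp add: C'_def)
    then show False
      using code_dim_GRS[OF v'(1) kn(2,1)] code_dim_GRS[OF assms(4,5) kn(3)]
      by (simp add: C'_def assms(7))
  qed
  interpret code_extension q "TYPE('a)" n C C' w
    by unfold_locales (use closed[of n k a v] closed[of n "k + 1" a v'] v' \<open>w \<notin> C\<close> assms(7) in \<open>simp_all add: C'_def\<close>)
  \<comment> \<open>Reduces each existence claim to a lower bound for the hull of C', since lowering
    the hull keeps length and dimension.\<close>
  have descent: "\<exists>D :: 'a vec set. is_GRS_code n D \<and> linear_code n (k + 1) D \<and>
      code_dim n (herm_hull q n D) = s" if le: "s \<le> code_dim n (herm_hull q n C')" for s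
  proof -
    obtain v'' where v'': "GRS_params n a v''" "code_dim n (herm_hull q n (GRS n (k + 1) a v'')) = s"
      using GRS_hull_descent[OF v'(1) le[unfolded C'_def]] by blast
    then show ?thesis
      using kn(1,2) lin_closed_subspace[OF closed] code_dim_GRS[OF v''(1) kn(2,1)]
      unfolding is_GRS_code_def linear_code_def by blast
  qed
  have S: "S = herm_mat w n"
    by (simp add: assms(12) herm_mat_def)
  show ?thesis
  proof (intro conjI impI allI; (elim conjE)?)
    show "\<exists>D :: 'a vec set. is_GRS_code n D \<and> linear_code n (k + 1) D \<and> code_dim n (herm_hull q n D) = s"
      if "s \<le> l + 1" "w \<in> herm_dual q n C" "herm_sq q w = 0" for s
      using that hull_dim_isotropic assms(9) by (intro descent) simp
    show "\<exists>D :: 'a vec set. is_GRS_code n D \<and> linear_code n (k + 1) D \<and> code_dim n (herm_hull q n D) = s"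
      if "int s \<le> int l - 1" for s
      using that hull_dim_general assms(9) by (intro descent) simp
    show "\<exists>D :: 'a vec set. is_GRS_code n D \<and> linear_code n (k + 1) D \<and> code_dim n (herm_hull q n D) = s"
      if "w \<in> herm_dual q n (herm_hull q n C)" "s \<le> l" for s
      using that hull_dim_perp assms(9) by (intro descent) simp
    show "vec_space.rank n S = n - 1" if "herm_sq q w \<noteq> 0"
      unfolding S using that by (intro rank_herm_mat) simp
    show "\<exists>D :: 'a vec set. is_GRS_code n D \<and> linear_code n (k + 1) D \<and> code_dim n (herm_hull q n D) = s"
      if "herm_sq q w \<noteq> 0" "int s \<le> int k - int (vec_space.rank k (G * S * hdagger q G))" for s
      using that hull_dim_anisotropic[OF assms(4,5) kn(3) assms(7)]
      by (intro descent) (simp add: S assms(8))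
  qed
qed

end
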